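(* Let $n\ge 2$, let $w\in\widetilde{C}_n$, and let $i,j\in\mathbb{Z}\setminus (n+1)\mathbb{Z}$ with $i\not\equiv j \pmod{2n+2}$. Then $$w\, t^c_{i,j} = t^c_{w(i),w(j)}\, w .$$
   Context: $\widetilde{C}_n$ is the affine Weyl group of type C, with generators $s_0,s_1,\dots,s_n$ and relations $s_i^2=1$; $s_is_j=s_js_i$ if $|i-j|>1$; $s_is_{i+1}s_i=s_{i+1}s_is_{i+1}$ for $1\le i\le n-2$; $s_0s_1s_0s_1=s_1s_0s_1s_0$; $s_{n-1}s_ns_{n-1}s_n=s_ns_{n-1}s_ns_{n-1}$. It is realized (faithfully) as a group of permutations of $\mathbb{Z}$, with product being composition, as follows (all congruences modulo $2n+2$): - for $0<i<n$: $s_i(x)=x+1$ if $x\equiv i$ or $x\equiv -i-1$; $s_i(x)=x-1$ if $x\equiv i+1$ or $x\equiv -i$; $s_i(x)=x$ otherwise; - $s_0(x)=x+2$ if $x\equiv -1$; $s_0(x)=x-2$ if $x\equiv 1$; $s_0(x)=x$ otherwise; - $s_n(x)=x+2$ if $x\equiv n$; $s_n(x)=x-2$ if $x\equiv n+2$; $s_n(x)=x$ otherwise. Every $w\in\widetilde{C}_n$ satisfies $w(x)+w(2a(n+1)-x)=2a(n+1)$ for all $a,x\in\mathbb{Z}$; in particular $w(-x)=-w(x)$ and $w(a(n+1))=a(n+1)$. Type C transposition: for $i,j\in\mathbb{Z}\setminus(n+1)\mathbb{Z}$ with $i\not\equiv j\pmod{2n+2}$, $t^c_{i,j}$ is the unique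 element of $\widetilde{C}_n$ such that for all $q\in\mathbb{Z}$ $$t^c_{i,j}(i+q(2n+2))=j+q(2n+2),\quad t^c_{i,j}(j+q(2n+2))=i+q(2n+2),$$ $$t^c_{i,j}(-i+q(2n+2))=-j+q(2n+2),\quad t^c_{i,j}(-j+q(2n+2))=-i+q(2n+2),$$ and $t^c_{i,j}(x)=x$ for all other $x\in\mathbb{Z}$. *)

theory Defs
  imports "HOL-Algebra.Bij" "HOL-Algebra.Generated_Groups" "HOL-Number_Theory.Cong"
begin

definition affine_C_gen :: "nat \<Rightarrow> nat \<Rightarrow> int \<Rightarrow> int" where
  "affine_C_gen n i x =
    (if i = 0 then
       (if [x = - 1] (mod (2 * int n + 2)) then x + 2
        else if [x = 1] (mod (2 * int n + 2)) then x - 2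
        else x)
     else if i = n then
       (if [x = int n] (mod (2 * int n + 2)) then x + 2
        else if [x = int n + 2] (mod (2 * int n + 2)) then x - 2
        else x)
     else
       (if [x = int i] (mod (2 * int n + 2)) \<or> [x = - int i - 1] (mod (2 * int n + 2)) then x + 1
        else if [x = int i + 1] (mod (2 * int n + 2)) \<or> [x = - int i] (mod (2 * int n + 2)) then x - 1
        else x))"

text \<open>The affine Weyl group of type C, in its faithful realization by permutations of the
  integers: the subgroup generated by s_0, ..., s_n. The group operation is composition.\<close>

definition affine_C :: "nat \<Rightarrow> (int \<Rightarrow> int) set" where
  "affine_C n = generate (BijGroup UNIV) (affine_C_gen n ` {0..n})"

definition is_transp_C :: "nat \<Rightarrow> int \<Rightarrow> int \<Rightarrow> (int \<Rightarrow> int) \<Rightarrow> bool" where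
  "is_transp_C n i j t \<longleftrightarrow>
    (\<forall>q. t (i + q * (2 * int n + 2)) = j + q * (2 * int n + 2) \<and>
         t (j + q * (2 * int n + 2)) = i + q * (2 * int n + 2) \<and>
         t (- i + q * (2 * int n + 2)) = - j + q * (2 * int n + 2) \<and>
         t (- j + q * (2 * int n + 2)) = - i + q * (2 * int n + 2)) \<and>
    (\<forall>x. (\<forall>q. x \<notin> {i + q * (2 * int n + 2), j + q * (2 * int n + 2),
                     - i + q * (2 * int n + 2), - j + q * (2 * int n + 2)}) \<longrightarrow> t x = x)"

text \<open>Meaningful only if neither i nor j is a multiple of n + 1 and i, j are incongruent
  modulo 2n + 2.\<close>

definition transp_C :: "nat \<Rightarrow> int \<Rightarrow> int \<Rightarrow> int \<Rightarrow> int" where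
  "transp_C n i j = (THE t. t \<in> affine_C n \<and> is_transp_C n i j t)"

end

theory Submission imports Defs begin

text \<open>Conjugation by w turns an element satisfying the conditions for (i, j) into one
  satisfying those for (w i, w j), and these conditions determine the element, so all that has to
  be shown is that the group contains a transposition for every admissible pair. The generators
  are the transpositions of neighbouring non-multiples of n + 1; the general case i < j follows by
  induction on j - i, conjugating with a generator that brings the two closer together.\<close>

section \<open>Uniqueness and symmetries of transpositions\<close>

lemma is_transp_CD:
  assumes "is_transp_C n i j t"
  shows "t (i + q * (2 * int n + 2)) = j + q * (2 * int n + 2)"
    and "t (j + q * (2 * int n + 2)) = i + q * (2 * int n + 2)"
    and "t (- i + q * (2 * int n + 2)) = - j + q * (2 * int n + 2)"
    and "t (- j + q * (2 * int n + 2)) = - i + q * (2 * int n + 2)"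
    and "(\<And>q. x \<notin> {i + q * (2 * int n + 2), j + q * (2 * int n + 2),
                     - i + q * (2 * int n + 2), - j + q * (2 * int n + 2)}) \<Longrightarrow> t x = x"
  using assms unfolding is_transp_C_def by blast+

text \<open>Splits along the clauses of \<open>is_transp_C\<close>. The first four cases may
  overlap; this does no harm, since a \<open>t\<close> with \<open>is_transp_C n i j t\<close>
  satisfies all clauses at once.\<close>

lemma transp_C_cases:
  fixes n :: nat and i j x :: int
  obtains q where "x = i + q * (2 * int n + 2)"
  | q where "x = j + q * (2 * int n + 2)"
  | q where "x = - i + q * (2 * int n + 2)"
  | q where "x = - j + q * (2 * int n + 2)"
  | "\<And>q. x \<notin> {i + q * (2 * int n + 2), j + q * (2 * int n + 2),
                     - i + q * (2 * int n + 2), - j + q * (2 * int n + 2)}"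
  by blast

lemma is_transp_C_unique:
  assumes "is_transp_C n i j t" "is_transp_C n i j t'"
  shows "t = t'"
proof
  fix x show "t x = t' x"
    by (rule transp_C_cases[where x = x and n = n and i = i and j = j])
      (simp_all only: is_transp_CD(1-4)[OF assms(1)] is_transp_CD(1-4)[OF assms(2)],
        metis is_transp_CD(5)[OF assms(1)] is_transp_CD(5)[OF assms(2)])
qed

lemma is_transp_C_swap: "is_transp_C n i j t \<Longrightarrow> is_transp_C n j i t"
  unfolding is_transp_C_def by blast

lemma is_transp_C_uminus: "is_transp_C n i j t \<Longrightarrow> is_transp_C n (- i) (- j) t"
  unfolding is_transp_C_def by auto

lemma is_transp_C_shift:
  assumes "is_transp_C n i j t"
  shows "is_transp_C n (i + k * (2 * int n + 2)) (j + k * (2 * int n + 2)) t"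
proof -
  let ?M = "2 * int n + 2"
  have e: "y + k * ?M + q * ?M = y + (k + q) * ?M"
    "- (y + k * ?M) + q * ?M = - y + (q - k) * ?M" for y q
    by (simp_all add: algebra_simps)
  have "t x = x" if "\<forall>q. x \<notin> {i + (k + q) * ?M, j + (k + q) * ?M, - i + (q - k) * ?M, - j + (q - k) * ?M}" for x
  proof (rule is_transp_CD(5)[OF assms])
    fix q
    show "x \<notin> {i + q * ?M, j + q * ?M, - i + q * ?M, - j + q * ?M}"
      \<comment> \<open>The shift enters the classes of \<open>i, j\<close> and of
        \<open>- i, - j\<close> with opposite signs, hence two instances.\<close>
      using that[rule_format, of "q - k"] that[rule_format, of "q + k"] by simp
  qed
  then show ?thesis
    unfolding is_transp_C_def e using is_transp_CD(1-4)[OF assms] by blast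
qed

section \<open>Odd periodic permutations and conjugation\<close>

text \<open>Collects the properties of \<open>w\<close> that conjugating a transposition requires;
  for \<open>0 < n\<close> every element of \<open>affine_C n\<close> has them
  (\<open>affine_C_sym_perms\<close>).\<close>

definition sym_perms :: "nat \<Rightarrow> (int \<Rightarrow> int) set" where
  "sym_perms n = {w. bij w \<and> (\<forall>x q. w (x + q * (2 * int n + 2)) = w x + q * (2 * int n + 2)) \<and>
    (\<forall>x. w (- x) = - w x)}"

lemma is_transp_C_involution:
  assumes "is_transp_C n i j t"
  shows "t (t x) = x"
  by (rule transp_C_cases[where x = x and n = n and i = i and j = j]) (simp_all only: is_transp_CD(1-4)[OF assms], metis is_transp_CD(5)[OF assms])

text \<open>Bijectivity holds because \<open>t\<close> is an involution. The union of the four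
  classes, and so its complement, is stable under negation and under translation by the
  period.\<close>

lemma is_transp_C_sym_perms:
  assumes "is_transp_C n i j t"
  shows "t \<in> sym_perms n"
proof -
  let ?M = "2 * int n + 2"
  have "bij t"
    using is_transp_C_involution[OF assms] by (metis bij_def injI surjI)
  moreover have "t (x + k * ?M) = t x + k * ?M" for x k
  proof -
    have e: "y + q * ?M + k * ?M = y + (q + k) * ?M" for y q
      by (simp add: algebra_simps)
    show ?thesis
    proof (rule transp_C_cases[where x = x and n = n and i = i and j = j])
      assume a: "\<And>q. x \<notin> {i + q * ?M, j + q * ?M, - i + q * ?M, - j + q * ?M}"
      have "t (x + k * ?M) = x + k * ?M"
      proof (rule is_transp_CD(5)[OF assms])
        fix q
        show "x + k * ?M \<notin> {i + q * ?M, j + q * ?M, - i + q * ?M, - j + q * ?M}"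
          using a[of "q - k"] by (auto simp: algebra_simps)
      qed
      then show ?thesis using is_transp_CD(5)[OF assms a] by simp
    qed (simp_all only: e is_transp_CD(1-4)[OF assms])
  qed
  moreover have "t (- x) = - t x" for x
  proof -
    have e: "- (y + q * ?M) = - y + (- q) * ?M" for y q
      by (simp add: algebra_simps)
    show ?thesis
    proof (rule transp_C_cases[where x = x and n = n and i = i and j = j])
      assume a: "\<And>q. x \<notin> {i + q * ?M, j + q * ?M, - i + q * ?M, - j + q * ?M}"
      have "t (- x) = - x"
      proof (rule is_transp_CD(5)[OF assms])
        fix q
        show "- x \<notin> {i + q * ?M, j + q * ?M, - i + q * ?M, - j + q * ?M}"
          using a[of "- q"] by (auto simp: algebra_simps)
      qed
      then show ?thesis using is_transp_CD(5)[OF assms a] by simp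
    qed (simp_all only: e is_transp_CD(1-4)[OF assms] minus_minus)
  qed
  ultimately show ?thesis by (simp add: sym_perms_def)
qed

text \<open>The conjugate sends \<open>w y\<close> to \<open>w (t y)\<close>, and periodicity and
  oddness make \<open>w\<close> carry the four classes of \<open>i, j\<close> to those of
  \<open>w i, w j\<close>.\<close>

lemma is_transp_C_conj:
  assumes w: "w \<in> sym_perms n" and t: "is_transp_C n i j t"
  shows "is_transp_C n (w i) (w j) (w \<circ> t \<circ> inv_into UNIV w)"
proof -
  let ?M = "2 * int n + 2"
  \<comment> \<open>Both equations are oriented to pull signs and shifts inside \<open>w\<close>, so
    that the classes in the goal become images under \<open>w\<close>.\<close>
  have b: "bij w" and p: "\<And>x q. w x + q * ?M = w (x + q * ?M)" and o: "\<And>x. - w x = w (- x)"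
    using w by (auto simp: sym_perms_def)
  have iw: "inv_into UNIV w (w x) = x" for x
    using b by (simp add: bij_is_inj)
  have "w (t (inv_into UNIV w x)) = x"
    if a: "\<forall>q. x \<notin> {w (i + q * ?M), w (j + q * ?M), w (- i + q * ?M), w (- j + q * ?M)}" for x
  proof -
    have x: "x = w (inv_into UNIV w x)"
      using b by (simp add: bij_is_surj surj_f_inv_f)
    have "t (inv_into UNIV w x) = inv_into UNIV w x"
    proof (rule is_transp_CD(5)[OF t])
      fix q
      show "inv_into UNIV w x \<notin> {i + q * ?M, j + q * ?M, - i + q * ?M, - j + q * ?M}"
        using a[rule_format, of q] x by auto
    qed
    then show ?thesis using x by simp
  qed
  then show ?thesis
    unfolding is_transp_C_def o p using is_transp_CD(1-4)[OF t] by (simp add: iw)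
qed

section \<open>The generators are transpositions\<close>

text \<open>Phrased with congruences and displacements to match the form of
  \<open>affine_C_gen\<close>.\<close>

lemma is_transp_CI:
  assumes "\<And>x. [x = i] (mod (2 * int n + 2)) \<Longrightarrow> t x = x + (j - i)"
    and "\<And>x. [x = j] (mod (2 * int n + 2)) \<Longrightarrow> t x = x - (j - i)"
    and "\<And>x. [x = - i] (mod (2 * int n + 2)) \<Longrightarrow> t x = x - (j - i)"
    and "\<And>x. [x = - j] (mod (2 * int n + 2)) \<Longrightarrow> t x = x + (j - i)"
    and "\<And>x. \<lbrakk>\<not> [x = i] (mod (2 * int n + 2)); \<not> [x = j] (mod (2 * int n + 2));
      \<not> [x = - i] (mod (2 * int n + 2)); \<not> [x = - j] (mod (2 * int n + 2))\<rbrakk> \<Longrightarrow> t x = x"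
  shows "is_transp_C n i j t"
proof -
  let ?M = "2 * int n + 2"
  have c: "[a + q * ?M = a] (mod ?M)" for a q
    by (simp add: cong_iff_dvd_diff)
  have "t x = x"
    if "\<forall>q. x \<notin> {i + q * ?M, j + q * ?M, - i + q * ?M, - j + q * ?M}" for x
  proof -
    have "\<not> [x = a] (mod ?M)" if "\<forall>q. x \<noteq> a + q * ?M" for a
      using that by (metis cong_iff_lin cong_sym mult.commute)
    then show ?thesis using assms(5)[of x] that by blast
  qed
  then show ?thesis
    unfolding is_transp_C_def using assms(1)[OF c] assms(2)[OF c] assms(3)[OF c] assms(4)[OF c]
    by simp
qed

text \<open>Serves to exclude the earlier branches of the \<open>if\<close> cascade in
  \<open>affine_C_gen\<close>.\<close>

lemma not_cong_if_close:
  fixes a b m x :: int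
  assumes "[x = a] (mod m)" "a \<noteq> b" "\<bar>a - b\<bar> < m"
  shows "\<not> [x = b] (mod m)"
proof
  assume "[x = b] (mod m)"
  with assms(1) have "m dvd a - b"
    by (meson cong_iff_dvd_diff cong_sym cong_trans)
  then show False
    using assms(2,3) dvd_imp_le_int[of "a - b" m] by auto
qed

text \<open>Only the two classes moved down need work: \<open>affine_C_gen\<close> tests them
  second, so the classes moved up must be ruled out first.\<close>

lemma affine_C_gen_is_transp_mid:
  assumes "0 < k" "k < n"
  shows "is_transp_C n (int k) (int k + 1) (affine_C_gen n k)"
proof (rule is_transp_CI)
  fix x
  assume a: "[x = int k + 1] (mod (2 * int n + 2))"
  show "affine_C_gen n k x = x - (int k + 1 - int k)"
    using not_cong_if_close[OF a, of "int k"] not_cong_if_close[OF a, of "- int k - 1"] a assms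
    by (simp add: affine_C_gen_def)
next
  fix x
  assume a: "[x = - int k] (mod (2 * int n + 2))"
  show "affine_C_gen n k x = x - (int k + 1 - int k)"
    using not_cong_if_close[OF a, of "int k"] not_cong_if_close[OF a, of "- int k - 1"] a assms
    by (simp add: affine_C_gen_def)
qed (use assms in \<open>auto simp: affine_C_gen_def\<close>)

text \<open>Here the two points are negatives of each other, so the four classes collapse to
  two.\<close>

lemma affine_C_gen_is_transp_0:
  assumes "0 < n"
  shows "is_transp_C n (- 1) 1 (affine_C_gen n 0)"
proof (rule is_transp_CI)
  fix x
  assume a: "[x = 1] (mod (2 * int n + 2))"
  show "affine_C_gen n 0 x = x - (1 - - 1)"
    using not_cong_if_close[OF a, of "- 1"] a assms by (simp add: affine_C_gen_def)
next
  fix x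
  assume a: "[x = - (- 1)] (mod (2 * int n + 2))"
  show "affine_C_gen n 0 x = x - (1 - - 1)"
    using not_cong_if_close[OF a, of "- 1"] a assms by (simp add: affine_C_gen_def)
qed (auto simp: affine_C_gen_def)

text \<open>The four classes again collapse to two, since \<open>- n\<close> and
  \<open>n + 2\<close> differ by exactly one period.\<close>

lemma affine_C_gen_is_transp_n:
  assumes "0 < n"
  shows "is_transp_C n (int n) (int n + 2) (affine_C_gen n n)"
proof -
  let ?M = "2 * int n + 2"
  have e: "[x = - int n] (mod ?M) \<longleftrightarrow> [x = int n + 2] (mod ?M)"
    "[x = - (int n + 2)] (mod ?M) \<longleftrightarrow> [x = int n] (mod ?M)" for x
  proof -
    have "[- int n = int n + 2] (mod ?M)" "[- (int n + 2) = int n] (mod ?M)"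
      unfolding cong_iff_lin by (rule exI[of _ 1]; simp)+
    then show "[x = - int n] (mod ?M) \<longleftrightarrow> [x = int n + 2] (mod ?M)"
      "[x = - (int n + 2)] (mod ?M) \<longleftrightarrow> [x = int n] (mod ?M)"
      by (meson cong_sym cong_trans)+
  qed
  have up: "affine_C_gen n n x = x - 2" if "[x = int n + 2] (mod ?M)" for x
    using not_cong_if_close[OF that, of "int n"] that assms by (simp add: affine_C_gen_def)
  show ?thesis
    by (rule is_transp_CI; (unfold e)?) (use up assms in \<open>auto simp: affine_C_gen_def\<close>)
qed

lemma affine_C_gen_transp:
  assumes "0 < n" "k \<le> n"
  shows "\<exists>i j. is_transp_C n i j (affine_C_gen n k)"
  using assms affine_C_gen_is_transp_mid[of k n] affine_C_gen_is_transp_0[of n]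
    affine_C_gen_is_transp_n[of n]
  by (metis le_neq_implies_less neq0_conv)

section \<open>The generated group in terms of composition and inverse functions\<close>

lemma affine_C_gen_mem: "k \<le> n \<Longrightarrow> affine_C_gen n k \<in> affine_C n"
  unfolding affine_C_def by (intro generate.incl) auto

lemma carrier_BijGroup_UNIV: "f \<in> carrier (BijGroup UNIV) \<longleftrightarrow> bij f"
  by (simp add: BijGroup_def Bij_def)

lemma mult_BijGroup_UNIV: "bij f \<Longrightarrow> bij g \<Longrightarrow> f \<otimes>\<^bsub>BijGroup UNIV\<^esub> g = f \<circ> g"
  by (simp add: BijGroup_def Bij_def compose_def comp_def fun_eq_iff)

lemma inv_BijGroup_UNIV: "bij f \<Longrightarrow> inv\<^bsub>BijGroup UNIV\<^esub> f = inv_into UNIV f"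
  by (simp add: inv_BijGroup Bij_def restrict_def)

lemma sym_perms_bij: "w \<in> sym_perms n \<Longrightarrow> bij w"
  by (simp add: sym_perms_def)

lemma sym_perms_id: "id \<in> sym_perms n"
  by (simp add: sym_perms_def)

lemma sym_perms_comp: "v \<in> sym_perms n \<Longrightarrow> w \<in> sym_perms n \<Longrightarrow> v \<circ> w \<in> sym_perms n"
  by (auto simp: sym_perms_def bij_comp)

lemma affine_C_sym_perms:
  assumes "0 < n" "w \<in> affine_C n"
  shows "w \<in> sym_perms n"
  using assms(2) unfolding affine_C_def
proof (induction rule: generate.induct)
  case one
  then show ?case using sym_perms_id[of n]
    by (simp add: BijGroup_def restrict_def id_def)
next
  case (incl h)
  then show ?case using affine_C_gen_transp[OF assms(1)] is_transp_C_sym_perms by fastforce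
next
  case (inv h)
  then obtain i j where t: "is_transp_C n i j h"
    using affine_C_gen_transp[OF assms(1)] by fastforce
  \<comment> \<open>Generators are involutions, so their inverses bring nothing new.\<close>
  have "inv_into UNIV h = h"
    using is_transp_C_involution[OF t] by (intro inv_equality) auto
  then show ?case
    using is_transp_C_sym_perms[OF t] inv_BijGroup_UNIV[of h] sym_perms_bij by metis
next
  case (eng v w)
  then show ?case by (metis mult_BijGroup_UNIV sym_perms_bij sym_perms_comp)
qed

lemma affine_C_bij: "0 < n \<Longrightarrow> w \<in> affine_C n \<Longrightarrow> bij w"
  using affine_C_sym_perms sym_perms_bij by blast

lemma affine_C_comp:
  assumes "0 < n" "v \<in> affine_C n" "w \<in> affine_C n"
  shows "v \<circ> w \<in> affine_C n"
  using generate.eng assms mult_BijGroup_UNIV affine_C_bij unfolding affine_C_def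
  by (metis (no_types, lifting))

lemma affine_C_inv:
  assumes "0 < n" "w \<in> affine_C n"
  shows "inv_into UNIV w \<in> affine_C n"
proof -
  have "affine_C_gen n ` {0..n} \<subseteq> carrier (BijGroup UNIV)"
    using affine_C_gen_mem affine_C_bij[OF assms(1)] by (auto simp: carrier_BijGroup_UNIV)
  from group.generate_m_inv_closed[OF group_BijGroup this] show ?thesis
    using assms inv_BijGroup_UNIV affine_C_bij unfolding affine_C_def by metis
qed

lemma affine_C_conj:
  "0 < n \<Longrightarrow> w \<in> affine_C n \<Longrightarrow> t \<in> affine_C n \<Longrightarrow> w \<circ> t \<circ> inv_into UNIV w \<in> affine_C n"
  by (intro affine_C_comp affine_C_inv)

section \<open>Existence of transpositions in the group\<close>

text \<open>Conjugating by \<open>s\<close> leads from \<open>(s i, s j)\<close> back to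
  \<open>(i, j)\<close>, because \<open>s\<close> is an involution.\<close>

lemma transp_exists_conj:
  assumes "0 < n" "s \<in> affine_C n" "is_transp_C n a b s"
    and "\<exists>t\<in>affine_C n. is_transp_C n (s i) (s j) t"
  shows "\<exists>t\<in>affine_C n. is_transp_C n i j t"
  using assms is_transp_C_conj[OF affine_C_sym_perms[OF assms(1,2)]] affine_C_conj
    is_transp_C_involution[OF assms(3)] by metis

lemma dvd_mult_period: "int n + 1 dvd q * (2 * int n + 2)"
proof (rule dvdI)
  show "q * (2 * int n + 2) = (int n + 1) * (2 * q)"
    by (simp add: algebra_simps)
qed

text \<open>Up to a multiple of the period, \<open>a\<close> lies either in the lower half, where it
  indexes a generator, or in the upper half, which negation maps to the lower one.\<close>

lemma adjacent_transp_exists: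
  assumes "0 < n" "\<not> int n + 1 dvd a" "\<not> int n + 1 dvd a + 1"
  shows "\<exists>t\<in>affine_C n. is_transp_C n a (a + 1) t"
proof -
  let ?M = "2 * int n + 2"
  define q where "q = a div ?M"
  define r where "r = a mod ?M"
  have a: "a = r + q * ?M" unfolding q_def r_def by (rule mod_div_mult_eq[symmetric])
  have r: "0 \<le> r" "r < ?M" by (simp_all add: r_def)
  have q: "int n + 1 dvd y + q * ?M \<longleftrightarrow> int n + 1 dvd y" for y
    using dvd_mult_period by (rule dvd_add_left_iff)
  have "a + 1 = r + 1 + q * ?M" using a by simp
  then have nd: "\<not> int n + 1 dvd r" "\<not> int n + 1 dvd r + 1"
    using assms(2,3) a by (metis q)+
  have r': "r \<noteq> 0" "r \<noteq> int n" "r \<noteq> int n + 1" "r \<noteq> 2 * int n + 1"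
    using nd dvd_mult_period[of n 1] by (auto simp: add.commute)
  show ?thesis
  proof (cases "r < int n")
    case True
    have "is_transp_C n r (r + 1) (affine_C_gen n (nat r))"
      using affine_C_gen_is_transp_mid[of "nat r" n] True r r' by simp
    from is_transp_C_shift[OF this, of q] show ?thesis
      using affine_C_gen_mem[of "nat r" n] True unfolding a by (auto simp: algebra_simps)
  next
    case False
    \<comment> \<open>Chosen so that \<open>- (k + 1)\<close> plus one period is \<open>r\<close>;
      this extra period is why the shift below is by \<open>q + 1\<close>.\<close>
    define k where "k = nat (2 * int n + 1 - r)"
    have k: "0 < k" "k < n" "r = 2 * int n + 1 - int k"
      using False r r' by (auto simp: k_def)
    from is_transp_C_shift[OF is_transp_C_swap[OF is_transp_C_uminus[OF
        affine_C_gen_is_transp_mid[OF k(1,2)]]], of "q + 1"]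
    show ?thesis
      using affine_C_gen_mem[of k n] k(2) unfolding a k(3) by (auto simp: algebra_simps)
  qed
qed

text \<open>Even multiples of \<open>n + 1\<close> are translates of \<open>0\<close>, odd ones of
  \<open>n + 1\<close>, so a shift of the first or the last generator does it.\<close>

lemma transp_across_multiple_exists:
  assumes "0 < n" "int n + 1 dvd a"
  shows "\<exists>t\<in>affine_C n. is_transp_C n (a - 1) (a + 1) t"
proof -
  obtain k where k: "a = (int n + 1) * k" using assms(2) by auto
  show ?thesis
  proof (cases "even k")
    case True
    then obtain q where "k = 2 * q" by auto
    then show ?thesis
      using is_transp_C_shift[OF affine_C_gen_is_transp_0[OF assms(1)], of q]
        affine_C_gen_mem[of 0 n] k by (auto simp: algebra_simps)
  next
    case False
    then obtain q where "k = 2 * q + 1" by (auto elim: oddE)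
    then show ?thesis
      using is_transp_C_shift[OF affine_C_gen_is_transp_n[OF assms(1)], of q]
        affine_C_gen_mem[of n n] k by (auto simp: algebra_simps)
  qed
qed

text \<open>Supplies the move of \<open>a\<close> to the next larger non-multiple of
  \<open>n + 1\<close>; a step of 2 is always enough, as two consecutive integers are never both
  multiples.\<close>

lemma step_up:
  assumes "1 < n" "\<not> int n + 1 dvd a"
  obtains d s where "d = (if int n + 1 dvd a + 1 then 2 else 1)" "s \<in> affine_C n"
    "is_transp_C n a (a + d) s" "\<not> int n + 1 dvd a + d"
proof (cases "int n + 1 dvd a + 1")
  case True
  then have "\<not> int n + 1 dvd a + 2"
    using dvd_diff[of "int n + 1" "a + 2" "a + 1"] assms(1) by (auto dest: zdvd_imp_le)
  with True show ?thesis
    using transp_across_multiple_exists[of n "a + 1"] assms(1) that[of 2]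
    by (auto simp: add.commute)
next
  case False
  then show ?thesis
    using adjacent_transp_exists[of n a] assms that[of 1] by auto
qed

lemma step_down:
  assumes "1 < n" "\<not> int n + 1 dvd b"
  obtains d s where "d = (if int n + 1 dvd b - 1 then 2 else 1)" "s \<in> affine_C n"
    "is_transp_C n (b - d) b s" "\<not> int n + 1 dvd b - d"
proof (cases "int n + 1 dvd b - 1")
  case True
  then have "\<not> int n + 1 dvd b - 2"
    using dvd_diff[of "int n + 1" "b - 1" "b - 2"] assms(1) by (auto dest: zdvd_imp_le)
  with True show ?thesis
    using transp_across_multiple_exists[of n "b - 1"] assms(1) that[of 2] by auto
next
  case False
  then show ?thesis
    using adjacent_transp_exists[of n "b - 1"] assms that[of 1] by auto
qed

text \<open>Let \<open>s\<close> move \<open>j\<close> down to the preceding non-multiple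
  \<open>j'\<close>. The induction hypothesis applies to \<open>(s i, j')\<close> if
  \<open>s\<close> fixes \<open>i\<close> or moves it up but keeps it below \<open>j'\<close>. Only
  for \<open>i\<close> in the class of \<open>- j'\<close> does \<open>s\<close> move
  \<open>i\<close> down.\<close>

lemma transp_exists_less:
  assumes n: "1 < n" and "i < j" "\<not> int n + 1 dvd i" "\<not> int n + 1 dvd j"
    and "\<not> [i = j] (mod (2 * int n + 2))"
  shows "\<exists>t\<in>affine_C n. is_transp_C n i j t"
  using assms(2-)
proof (induction "nat (j - i)" arbitrary: i j rule: less_induct)
  case less
  let ?N = "int n + 1"
  let ?M = "2 * int n + 2"
  have n0: "0 < n" using n by simp
  obtain d s where d: "d = (if ?N dvd j - 1 then 2 else 1)" and s: "s \<in> affine_C n"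
    and st: "is_transp_C n (j - d) j s" and ndj: "\<not> ?N dvd j - d"
    using step_down[OF n less.prems(3)] .
  define j' where "j' = j - d"
  have d12: "0 < d" "d \<le> 2" using d by auto
  have sj: "s j = j'"
    using is_transp_CD(2)[OF st, of 0] by (simp add: j'_def)
  have NM: "?N dvd q * ?M" for q by (rule dvd_mult_period)
  \<comment> \<open>The only integer that can lie strictly between \<open>j'\<close> and
    \<open>j\<close> is a multiple of \<open>n + 1\<close>, which \<open>i\<close> is not.\<close>
  have i_le: "i \<le> j'"
  proof (rule ccontr)
    assume "\<not> i \<le> j'"
    then have "i = j - 1" "d = 2" using less.prems(1) d12 by (auto simp: j'_def)
    then show False using d less.prems(2) by (auto split: if_splits)
  qed
  show ?case
  proof (cases "i = j'")
    case True
    then show ?thesis using s st j'_def by auto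
  next
    case False
    then have i_less: "i < j'" using i_le by simp
    have nij: "i \<noteq> j + q * ?M" for q
      using less.prems(4) by (auto simp: cong_iff_dvd_diff)
    \<comment> \<open>The bound 4 covers the sum of two steps, while the period is at least
      6.\<close>
    have small: "e \<noteq> q * ?M" if "0 < e" "e \<le> 4" for e q
      using that n zdvd_imp_le[of ?M e] by auto
    \<comment> \<open>In other words, \<open>j'\<close> is not congruent to its own
      negative.\<close>
    have not_half: "2 * j' \<noteq> q * ?M" for q
    proof
      assume "2 * j' = q * ?M"
      then have "j' = q * ?N" by (simp add: algebra_simps)
      then show False using ndj by (simp add: j'_def)
    qed
    have reduce: ?thesis if lt: "s i < j'" and gt: "i \<le> s i" and nd: "\<not> ?N dvd s i"
      and nc: "\<And>q. s i \<noteq> j' + q * ?M"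
    proof (rule transp_exists_conj[OF n0 s st], unfold sj, rule less.hyps)
      show "nat (j' - s i) < nat (j - i)" using lt gt d12 by (simp add: j'_def)
      show "\<not> [s i = j'] (mod ?M)"
        using nc by (metis cong_iff_lin cong_sym mult.commute)
    qed (use lt nd ndj in \<open>auto simp: j'_def\<close>)
    show ?thesis
    proof (rule transp_C_cases[where x = i and n = n and i = j' and j = j])
      fix q assume q: "i = j' + q * ?M"
      then have si: "s i = j + q * ?M"
        using is_transp_CD(1)[OF st] by (simp add: j'_def)
      have "q * ?M < 0" using q i_less by simp
      then have "q < 0" by (simp add: mult_less_0_iff)
      \<comment> \<open>So \<open>i\<close> is at least a full period below \<open>j'\<close>, and
        moving it up by \<open>d\<close> cannot reach \<open>j'\<close>.\<close>
      then have "q * ?M \<le> - 1 * ?M" by (intro mult_right_mono) auto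
      show ?thesis
      proof (rule reduce)
        show "s i < j'" using \<open>q * ?M \<le> - 1 * ?M\<close> d12 n by (simp add: si j'_def)
        show "i \<le> s i" unfolding si using d12 q by (simp add: j'_def)
        show "\<not> ?N dvd s i" using less.prems(3) NM by (simp add: si dvd_add_left_iff)
        show "s i \<noteq> j' + p * ?M" for p
        proof
          assume "s i = j' + p * ?M"
          then have "d = (p - q) * ?M" using si by (simp add: j'_def algebra_simps)
          then show False using small d12 by simp
        qed
      qed
    next
      fix q assume "i = j + q * ?M"
      then show ?thesis using nij by blast
    next
      \<comment> \<open>Here moving j down would move i down as well, so i is moved up instead.\<close>
      fix q assume q: "i = - j' + q * ?M"
      obtain d' s' where d': "d' = (if ?N dvd i + 1 then 2 else 1)" and s': "s' \<in> affine_C n"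
        and st': "is_transp_C n i (i + d') s'" and ndi: "\<not> ?N dvd i + d'"
        using step_up[OF n less.prems(2)] .
      have d'12: "0 < d'" "d' \<le> 2" using d' by auto
      have lt: "i + d' \<le> j'"
      proof (cases "?N dvd i + 1")
        case True
        \<comment> \<open>The skipped point \<open>i + 1\<close> is a multiple of
          \<open>n + 1\<close>, and \<open>j'\<close> is not.\<close>
        then have "i + 1 \<noteq> j'" using ndj by (auto simp: j'_def)
        then show ?thesis using i_less d'12 by simp
      qed (use i_less d' in auto)
      \<comment> \<open>Otherwise \<open>2 * j'\<close> would be congruent to \<open>d' - d\<close>.
        The period is even and both steps are 1 or 2, so parity forces \<open>d' = d\<close>,
        against \<open>not_half\<close>. This serves twice: \<open>s'\<close> fixes
        \<open>j\<close>, and the new pair is incongruent.\<close>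
      have far: "j \<noteq> i + d' + p * ?M" for p
      proof
        assume j: "j = i + d' + p * ?M"
        then have e: "2 * j' = (p + q) * ?M + (d' - d)"
          using q by (simp add: j'_def algebra_simps)
        have "even (d' - d)"
          using arg_cong[OF e, of even] by simp
        then have "d' = d" using d d' by (auto split: if_splits)
        then show False using e not_half[of "p + q"] by simp
      qed
      have "s' j = j"
      proof (rule is_transp_CD(5)[OF st'])
        fix p
        have "j \<noteq> i + p * ?M" using nij[of "- p"] by auto
        moreover have "j \<noteq> - i + p * ?M"
        proof
          assume "j = - i + p * ?M"
          then have "d = (p - q) * ?M" using q by (simp add: j'_def algebra_simps)
          then show False using small d12 by simp
        qed
        moreover have "j \<noteq> - (i + d') + p * ?M"
        proof
          assume "j = - (i + d') + p * ?M"
          then have "d + d' = (p - q) * ?M" using q by (simp add: j'_def algebra_simps)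
          then show False using small[of "d + d'"] d12 d'12 by simp
        qed
        ultimately show "j \<notin> {i + p * ?M, i + d' + p * ?M, - i + p * ?M, - (i + d') + p * ?M}"
          using far by blast
      qed
      moreover have "s' i = i + d'" using is_transp_CD(1)[OF st', of 0] by simp
      moreover have "\<exists>t\<in>affine_C n. is_transp_C n (i + d') j t"
      proof (rule less.hyps)
        show "nat (j - (i + d')) < nat (j - i)" using less.prems(1) d'12 by simp
        show "i + d' < j" using lt d12 by (simp add: j'_def)
        show "\<not> [i + d' = j] (mod ?M)"
          using far by (metis cong_iff_lin mult.commute)
      qed (use ndi less.prems(3) in auto)
      ultimately show ?thesis using transp_exists_conj[OF n0 s' st'] by simp
    next
      fix q assume q: "i = - j + q * ?M"
      then have si: "s i = - j' + q * ?M"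
        using is_transp_CD(4)[OF st] by (simp add: j'_def)
      show ?thesis
      proof (rule reduce)
        \<comment> \<open>The reflection about \<open>q * (n + 1)\<close> exchanges \<open>i\<close>
          with \<open>j\<close> and \<open>s i\<close> with \<open>j'\<close>, so its centre must
          lie below \<open>j'\<close>. From \<open>i < j'\<close> the centre is below
          \<open>j' + d / 2\<close>, hence at most \<open>j'\<close>, and equality is excluded
          here.\<close>
        have "j' \<noteq> q * ?N" using ndj by (auto simp: j'_def)
        moreover have "2 * (q * ?N) < 2 * j' + d" using q i_less by (simp add: j'_def algebra_simps)
        ultimately have "q * ?N < j'" using d12 by linarith
        then show "s i < j'" by (simp add: si algebra_simps)
        show "i \<le> s i" unfolding si using d12 q by (simp add: j'_def)
        have "?N dvd - j' + q * ?M \<longleftrightarrow> ?N dvd - j'" using NM by (intro dvd_add_left_iff)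
        then show "\<not> ?N dvd s i" using ndj unfolding si by (simp only: dvd_minus_iff j'_def) simp
        show "s i \<noteq> j' + p * ?M" for p
          using not_half[of "q - p"] by (simp add: si algebra_simps)
      qed
    next
      assume a: "\<And>q. i \<notin> {j' + q * ?M, j + q * ?M, - j' + q * ?M, - j + q * ?M}"
      then have "s i = i" using is_transp_CD(5)[OF st] by (simp add: j'_def)
      then show ?thesis using reduce i_less less.prems(2) a by auto
    qed
  qed
qed

lemma transp_exists:
  assumes n: "1 < n" and "\<not> int n + 1 dvd i" "\<not> int n + 1 dvd j"
    and "\<not> [i = j] (mod (2 * int n + 2))"
  shows "\<exists>t\<in>affine_C n. is_transp_C n i j t"
proof (cases i j rule: linorder_cases)
  case greater
  then show ?thesis
    using transp_exists_less[of n j i] assms is_transp_C_swap by (metis cong_sym)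
qed (use assms transp_exists_less[of n i j] in auto)

section \<open>Evaluation of the definite description and conclusion\<close>

lemma transp_C_eqI:
  assumes "t \<in> affine_C n" "is_transp_C n i j t"
  shows "transp_C n i j = t"
  unfolding transp_C_def using assms is_transp_C_unique by blast

theorem theorem3p15:
  fixes n :: nat and w :: "int \<Rightarrow> int" and i j :: int
  assumes "n \<ge> 2"
    and "w \<in> affine_C n"
    and "\<not> (int n + 1) dvd i"
    and "\<not> (int n + 1) dvd j"
    and "\<not> [i = j] (mod (2 * int n + 2))"
  shows "w \<circ> transp_C n i j = transp_C n (w i) (w j) \<circ> w"
proof -
  have n: "0 < n" "1 < n" using assms(1) by auto
  obtain t where t: "t \<in> affine_C n" "is_transp_C n i j t"
    using transp_exists[OF n(2) assms(3-5)] by blast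
  \<comment> \<open>The conjugate itself witnesses that the group contains a transposition for
    \<open>(w i, w j)\<close>.\<close>
  have "transp_C n (w i) (w j) = w \<circ> t \<circ> inv_into UNIV w"
    using affine_C_conj[OF n(1) assms(2) t(1)]
      is_transp_C_conj[OF affine_C_sym_perms[OF n(1) assms(2)] t(2)] by (rule transp_C_eqI)
  moreover have "inv_into UNIV w \<circ> w = id"
    using affine_C_bij[OF n(1) assms(2)] by (simp add: bij_is_inj)
  ultimately show ?thesis
    by (simp add: transp_C_eqI[OF t] comp_assoc)
qed

end
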